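(* Let $\mathbf{D}$ be a D-core algebra and $x,y\in D$. Then (1a) $x\sqcap(x\vee y)=x\sqcap x$ and (1b) $x\sqcup(x\wedge y)=x\sqcup x$.
   Context: Write $x\vee y:=\neg(\neg x\sqcap\neg y)$ and $x\wedge y:=\lrcorner(\lrcorner x\sqcup\lrcorner y)$. A D-core algebra is an algebra $(D;\sqcap,\sqcup,\neg,\lrcorner,\top,\bot)$ of type $(2,2,1,1,0,0)$ satisfying, for all $x,y,z\in D$: $x\sqcap y=y\sqcap x$; $x\sqcup y=y\sqcup x$; $\neg(x\sqcap x)=\neg x$; $\lrcorner(x\sqcup x)=\lrcorner x$; $x\sqcap(x\sqcup y)=x\sqcap x$; $x\sqcup(x\sqcap y)=x\sqcup x$; $x\sqcap(y\vee z)=(x\sqcap y)\vee(x\sqcap z)$; $x\sqcup(y\wedge z)=(x\sqcup y)\wedge(x\sqcup z)$; $\neg\neg(x\sqcap y)=x\sqcap y$; $\lrcorner\lrcorner(x\sqcup y)=x\sqcup y$; $x\sqcap\neg x=\bot$; $x\sqcup\lrcorner x=\top$; $(x\sqcap x)\sqcup(x\sqcap x)=(x\sqcup x)\sqcap(x\sqcup x)$. *)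

theory Defs
  imports Main
begin

text \<open>The unary operation written as a negation sign is \<open>neg\<close>, the one written as a reversed
  corner (the opposition) is \<open>opp\<close>. The derived operations below are those for which the axioms
  \<open>meet_vee\<close> and \<open>join_wedge\<close> demand distributivity; in general they differ from \<open>\<squnion>\<close> and \<open>\<sqinter>\<close>.\<close>

definition vee :: "('a \<Rightarrow> 'a \<Rightarrow> 'a) \<Rightarrow> ('a \<Rightarrow> 'a) \<Rightarrow> 'a \<Rightarrow> 'a \<Rightarrow> 'a" where
  "vee meet neg x y = neg (meet (neg x) (neg y))"

definition wedge :: "('a \<Rightarrow> 'a \<Rightarrow> 'a) \<Rightarrow> ('a \<Rightarrow> 'a) \<Rightarrow> 'a \<Rightarrow> 'a \<Rightarrow> 'a" where
  "wedge join opp x y = opp (join (opp x) (opp y))"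

locale d_core_algebra =
  fixes meet :: "'a \<Rightarrow> 'a \<Rightarrow> 'a" (infixl "\<sqinter>" 70)
    and join :: "'a \<Rightarrow> 'a \<Rightarrow> 'a" (infixl "\<squnion>" 65)
    and neg :: "'a \<Rightarrow> 'a"
    and opp :: "'a \<Rightarrow> 'a"
    and top :: 'a ("\<top>")
    and bot :: 'a ("\<bottom>")
  assumes meet_commute: "x \<sqinter> y = y \<sqinter> x"
    and join_commute: "x \<squnion> y = y \<squnion> x"
    and neg_meet_self: "neg (x \<sqinter> x) = neg x"
    and opp_join_self: "opp (x \<squnion> x) = opp x"
    and meet_absorb: "x \<sqinter> (x \<squnion> y) = x \<sqinter> x"
    and join_absorb: "x \<squnion> (x \<sqinter> y) = x \<squnion> x"
    and meet_vee: "x \<sqinter> vee (\<sqinter>) neg y z = vee (\<sqinter>) neg (x \<sqinter> y) (x \<sqinter> z)"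
    and join_wedge: "x \<squnion> wedge (\<squnion>) opp y z = wedge (\<squnion>) opp (x \<squnion> y) (x \<squnion> z)"
    and neg_neg_meet: "neg (neg (x \<sqinter> y)) = x \<sqinter> y"
    and opp_opp_join: "opp (opp (x \<squnion> y)) = x \<squnion> y"
    and meet_neg: "x \<sqinter> neg x = \<bottom>"
    and join_opp: "x \<squnion> opp x = \<top>"
    and meet_self_join_self: "(x \<sqinter> x) \<squnion> (x \<sqinter> x) = (x \<squnion> x) \<sqinter> (x \<squnion> x)"

end

theory Submission
  imports Defs
begin

text \<open>Each half of a D-core algebra is treated separately. Since \<open>x = x \<sqinter> x\<close> may fail and \<open>\<sqinter>\<close> is
  not assumed associative, one works up to squares: \<open>x \<sqinter> (y \<sqinter> y) = x \<sqinter> y\<close> and \<open>\<not>\<not>x = x \<sqinter> x\<close>. The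
  mixed absorption law makes \<open>\<top> = x \<squnion> \<lrcorner>x\<close> a unit for \<open>\<sqinter>\<close> up to squares. Huntington's derivation
  of absorption then applies:
  \<open>x \<sqinter> (x \<or> y) = (x \<or> \<bottom>) \<sqinter> (x \<or> y) = x \<or> (\<bottom> \<sqinter> y) = x \<or> \<bottom> = x \<sqinter> x\<close>.\<close>

locale huntington_up_to_squares =
  fixes meet :: "'a \<Rightarrow> 'a \<Rightarrow> 'a" (infixl "\<sqinter>" 70)
    and neg :: "'a \<Rightarrow> 'a"
    and top :: 'a ("\<top>")
    and bot :: 'a ("\<bottom>")
  assumes meet_commute: "x \<sqinter> y = y \<sqinter> x"
    and neg_meet_self: "neg (x \<sqinter> x) = neg x"
    and meet_vee: "x \<sqinter> vee (\<sqinter>) neg y z = vee (\<sqinter>) neg (x \<sqinter> y) (x \<sqinter> z)"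
    and neg_neg_meet: "neg (neg (x \<sqinter> y)) = x \<sqinter> y"
    and meet_neg: "x \<sqinter> neg x = \<bottom>"
    and meet_top: "x \<sqinter> \<top> = x \<sqinter> x"
begin

abbreviation vee' (infixl "\<curlyvee>" 65) where "x \<curlyvee> y \<equiv> vee (\<sqinter>) neg x y"

lemma neg_neg: "neg (neg x) = x \<sqinter> x"
  by (metis neg_meet_self neg_neg_meet)

lemma vee_self: "x \<curlyvee> x = x \<sqinter> x"
  by (simp add: vee_def neg_meet_self neg_neg)

text \<open>The square of \<open>y\<close> is \<open>y \<curlyvee> y\<close>, so distributivity
  applies; a meet joined with itself collapses because double negation fixes meets.\<close>

lemma meet_square: "x \<sqinter> (y \<sqinter> y) = x \<sqinter> y"
proof -
  have "x \<sqinter> (y \<sqinter> y) = (x \<sqinter> y) \<curlyvee> (x \<sqinter> y)"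
    using meet_vee[of x y y] by (simp only: vee_self)
  also have "\<dots> = x \<sqinter> y"
    by (simp only: vee_def neg_meet_self neg_neg_meet)
  finally show ?thesis .
qed

lemma square_meet: "(x \<sqinter> x) \<sqinter> y = x \<sqinter> y"
  using meet_square[of y x] by (simp only: meet_commute)

lemma vee_commute: "x \<curlyvee> y = y \<curlyvee> x"
  by (simp add: vee_def meet_commute)

text \<open>The double negations on the right are squares, which a meet absorbs.\<close>

lemma neg_meet: "neg (x \<sqinter> y) = neg x \<curlyvee> neg y"
  by (simp only: vee_def neg_neg meet_square square_meet)

lemma neg_vee: "neg (x \<curlyvee> y) = neg x \<sqinter> neg y"
  by (simp add: vee_def neg_neg_meet)

text \<open>De Morgan dual of \<open>meet_vee\<close>, applied to the negated elements.\<close>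

lemma vee_meet: "x \<curlyvee> (y \<sqinter> z) = (x \<curlyvee> y) \<sqinter> (x \<curlyvee> z)"
proof -
  have "x \<curlyvee> (y \<sqinter> z) = neg (neg x \<sqinter> (neg y \<curlyvee> neg z))"
    by (simp only: vee_def[of _ _ x "y \<sqinter> z"] neg_meet[of y z])
  also have "\<dots> = neg (neg x \<sqinter> neg y) \<sqinter> neg (neg x \<sqinter> neg z)"
    by (simp only: meet_vee neg_vee)
  finally show ?thesis
    by (simp add: vee_def)
qed

lemma neg_top: "neg \<top> = \<bottom>"
proof -
  \<comment> \<open>Triple negation equals single negation, so every negation is its own
    square.\<close>
  have "neg \<top> = neg \<top> \<sqinter> neg \<top>"
    using neg_neg[of "neg \<top>"] by (simp only: neg_neg neg_meet_self)
  also have "\<dots> = \<top> \<sqinter> neg \<top>"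
    by (simp only: meet_top[symmetric] meet_commute[of \<top> "neg \<top>"])
  finally show ?thesis
    by (simp only: meet_neg)
qed

lemma vee_bot: "x \<curlyvee> \<bottom> = x \<sqinter> x"
proof -
  \<comment> \<open>Reading \<open>\<bottom>\<close> as \<open>neg \<top>\<close> makes its negation
    the square of the unit.\<close>
  have "x \<curlyvee> \<bottom> = neg (neg x \<sqinter> (\<top> \<sqinter> \<top>))"
    by (simp only: vee_def neg_top[symmetric] neg_neg)
  then show ?thesis
    by (simp only: meet_square) (simp only: meet_top neg_meet_self neg_neg)
qed

lemma meet_bot: "x \<sqinter> \<bottom> = \<bottom>"
proof -
  \<comment> \<open>A meet is its own square, so joining it with \<open>\<bottom>\<close> changes
    nothing.\<close>
  have "x \<sqinter> \<bottom> = (x \<sqinter> \<bottom>) \<curlyvee> \<bottom>"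
    using neg_neg[of "x \<sqinter> \<bottom>"] by (simp only: vee_bot neg_neg_meet)
  \<comment> \<open>The added \<open>\<bottom>\<close> is \<open>x \<sqinter> neg x\<close>, so
    \<open>x\<close> factors out.\<close>
  also have "\<dots> = x \<sqinter> (\<bottom> \<curlyvee> neg x)"
    by (simp add: meet_vee meet_neg)
  also have "\<dots> = \<bottom>"
    by (simp only: vee_commute[of \<bottom> "neg x"] vee_bot meet_square meet_neg)
  finally show ?thesis .
qed

lemma meet_vee_absorb: "x \<sqinter> (x \<curlyvee> y) = x \<sqinter> x"
proof -
  have "x \<sqinter> (x \<curlyvee> y) = (x \<curlyvee> \<bottom>) \<sqinter> (x \<curlyvee> y)"
    by (simp only: vee_bot square_meet)
  also have "\<dots> = x \<curlyvee> (\<bottom> \<sqinter> y)"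
    by (simp add: vee_meet)
  finally show ?thesis
    by (simp add: meet_commute[of \<bottom> y] meet_bot vee_bot)
qed

end

context d_core_algebra
begin

text \<open>One formula underlies both derived operations, so a single locale serves both
  halves.\<close>

lemma wedge_eq_vee: "wedge (\<squnion>) opp = vee (\<squnion>) opp"
  by (simp add: fun_eq_iff wedge_def vee_def)

lemma meet_huntington: "huntington_up_to_squares (\<sqinter>) neg \<top> \<bottom>"
proof
  show "x \<sqinter> \<top> = x \<sqinter> x" for x
    using meet_absorb[of x "opp x"] by (simp add: join_opp)
qed (fact meet_commute neg_meet_self meet_vee neg_neg_meet meet_neg)+

text \<open>In the dual half \<open>\<bottom>\<close> is the unit up to squares and
  \<open>\<top>\<close> the zero.\<close>

lemma join_huntington: "huntington_up_to_squares (\<squnion>) opp \<bottom> \<top>"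
proof
  show "x \<squnion> \<bottom> = x \<squnion> x" for x
    using join_absorb[of x "neg x"] by (simp add: meet_neg)
qed (fact join_commute opp_join_self join_wedge[unfolded wedge_eq_vee] opp_opp_join join_opp)+

end

theorem theorem3p8:
  fixes meet :: "'a \<Rightarrow> 'a \<Rightarrow> 'a" (infixl "\<sqinter>" 70)
    and join :: "'a \<Rightarrow> 'a \<Rightarrow> 'a" (infixl "\<squnion>" 65)
    and neg opp :: "'a \<Rightarrow> 'a"
    and top bot :: 'a
    and x y :: 'a
  assumes "d_core_algebra (\<sqinter>) (\<squnion>) neg opp top bot"
  shows "x \<sqinter> vee (\<sqinter>) neg x y = x \<sqinter> x \<and>
         x \<squnion> wedge (\<squnion>) opp x y = x \<squnion> x"
  using huntington_up_to_squares.meet_vee_absorb[OF d_core_algebra.meet_huntington[OF assms]]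
    huntington_up_to_squares.meet_vee_absorb[OF d_core_algebra.join_huntington[OF assms]]
    d_core_algebra.wedge_eq_vee[OF assms]
  by simp

end
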